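(* Let $\{S(t)\}_{t\ge0}$ be a twin semigroup on a norming dual pair $(Y,Y^\diamond)$ and assume that $(Y^\diamond,\sigma(Y^\diamond,Y))$ is sequentially complete. Let $q^\diamond\in Y^\diamond$. For $y\in Y$ define $V(\sigma)y=0$ for $\sigma=0$ and $V(\sigma)y=q^\diamond S(\sigma)y$ for $\sigma>0$. Assume that for all $y\in Y$ the function $\sigma\mapsto V(\sigma)y$ belongs to $NBV_{loc}([0,\infty);\mathbb R)$. Let $F:[0,\infty)\to\mathbb R$ be locally bounded and measurable. Then, for each $t>0$, there exists $u^\diamond(t)\in Y^\diamond$ such that for all $y\in Y$ $$\int_{[0,t]}F(t-\sigma)\,d_\sigma\bigl[V(\sigma)y\bigr]=\langle u^\diamond(t),y\rangle .$$
   Context: Banach spaces $Y,Y^\diamond$ (real) form a norming dual pair if there is a bilinear map $\langle\cdot,\cdot\rangle:Y^\diamond\times Y\to\mathbb R$ with $|\langle y^\diamond,y\rangle|\le M\|y^\diamond\|\|y\|$ for some $M\ge1$, $\|y\|=\sup\{|\langle y^\diamond,y\rangle|:\|y^\diamond\|\le1\}$ and $\|y^\diamond\|=\sup\{|\langle y^\diamond,y\rangle|:\|y\|\le1\}$. $\sigma(Y^\diamond,Y)$ is the weak topology on $Y^\diamond$ induced by $Y$. A twin operator $L$ is a bounded bilinear map $Y^\diamond\times Y\to\mathbb R$, $(y^\diamond,y)\mapsto y^\diamond Ly$, such that for each $y$ there is $Ly\in Y$ with $\langle y^\diamond,Ly\rangle=y^\diamond Ly$ for all $y^\diamond$, and for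 each $y^\diamond$ there is $y^\diamond L\in Y^\diamond$ with $\langle y^\diamond L,y\rangle=y^\diamond Ly$ for all $y$. Composition: $y^\diamond L_1L_2y:=\langle y^\diamond L_1,L_2y\rangle$. A twin semigroup is a family $\{S(t)\}_{t\ge0}$ of twin operators with: (i) $S(0)=I$, $S(t+s)=S(t)S(s)$; (ii) $|y^\diamond S(t)y|\le Me^{\omega t}\|y\|\|y^\diamond\|$ for some $M\ge1,\omega\in\mathbb R$; (iii) $t\mapsto y^\diamond S(t)y$ is measurable for all $y,y^\diamond$; (iv) for $\operatorname{Re}\lambda>\omega$ there is a twin operator $\overline S(\lambda)$ (on the complexification if $\lambda$ is non-real) with $y^\diamond\overline S(\lambda)y=\int_0^\infty e^{-\lambda t}y^\diamond S(t)y\,dt$. Measurable means Borel measurable. $NBV_{loc}([0,\infty))$: functions $G$ of locally bounded variation with $G(0)=0$, right-continuous on $(0,\infty)$; $dG$ is the Radon measure on $[0,\infty)$ with $dG([0,t])=G(t)$ for $t>0$ (so it has mass $G(0+)$ at $0$). *)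

theory Defs
  imports "HOL-Analysis.Analysis"
begin

section \<open>Norming dual pairs and twin operators\<close>

text \<open>
  Throughout, \<open>p x y\<close> is the pairing of \<open>x\<close> in the space \<open>'b\<close> (the ``diamond'' space) with
  \<open>y\<close> in \<open>'a\<close>. The bound \<open>|p x y| \<le> M \<parallel>x\<parallel> \<parallel>y\<parallel>\<close> is part of \<^const>\<open>bounded_bilinear\<close>; enlarging
  the constant one may always take \<open>M \<ge> 1\<close>.
\<close>

definition norming_dual_pair :: "('b::banach \<Rightarrow> 'a::banach \<Rightarrow> real) \<Rightarrow> bool" where
  "norming_dual_pair p \<longleftrightarrow>
     bounded_bilinear p \<and>
     (\<forall>y. norm y = (SUP x\<in>{x. norm x \<le> 1}. \<bar>p x y\<bar>)) \<and>
     (\<forall>x. norm x = (SUP y\<in>{y. norm y \<le> 1}. \<bar>p x y\<bar>))"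

definition twin_operator ::
  "('b::banach \<Rightarrow> 'a::banach \<Rightarrow> real) \<Rightarrow> ('b \<Rightarrow> 'a \<Rightarrow> real) \<Rightarrow> bool" where
  "twin_operator p L \<longleftrightarrow>
     bounded_bilinear L \<and>
     (\<forall>y. \<exists>z. \<forall>x. p x z = L x y) \<and>
     (\<forall>x. \<exists>z. \<forall>y. p z y = L x y)"

text \<open>
  For a twin operator on a norming dual pair, \<open>right_act p L y\<close> is the element \<open>Ly\<close> and
  \<open>left_act p L x\<close> the element \<open>xL\<close>; both are unique because the pairing separates points.
\<close>

definition right_act ::
  "('b::banach \<Rightarrow> 'a::banach \<Rightarrow> real) \<Rightarrow> ('b \<Rightarrow> 'a \<Rightarrow> real) \<Rightarrow> 'a \<Rightarrow> 'a" where
  "right_act p L y = (THE z. \<forall>x. p x z = L x y)"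

definition left_act ::
  "('b::banach \<Rightarrow> 'a::banach \<Rightarrow> real) \<Rightarrow> ('b \<Rightarrow> 'a \<Rightarrow> real) \<Rightarrow> 'b \<Rightarrow> 'b" where
  "left_act p L x = (THE z. \<forall>y. p z y = L x y)"

definition twin_comp ::
  "('b::banach \<Rightarrow> 'a::banach \<Rightarrow> real) \<Rightarrow> ('b \<Rightarrow> 'a \<Rightarrow> real) \<Rightarrow> ('b \<Rightarrow> 'a \<Rightarrow> real) \<Rightarrow> 'b \<Rightarrow> 'a \<Rightarrow> real"
  where
  "twin_comp p L1 L2 x y = p (left_act p L1 x) (right_act p L2 y)"

section \<open>Complexification\<close>

text \<open>
  The complexification of \<open>'a\<close> is carried by \<open>'a \<times> 'a\<close>, where \<open>(a, b)\<close> stands for \<open>a + i b\<close>.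
  The product norm is equivalent to every norm customarily put on the complexification, so
  it yields the same bounded maps.
\<close>

definition cscale :: "complex \<Rightarrow> 'a::real_vector \<times> 'a \<Rightarrow> 'a \<times> 'a" where
  "cscale c z = (Re c *\<^sub>R fst z - Im c *\<^sub>R snd z, Re c *\<^sub>R snd z + Im c *\<^sub>R fst z)"

text \<open>The complex bilinear extension of a real bilinear map:\<close>

definition complexify :: "('b \<Rightarrow> 'a \<Rightarrow> real) \<Rightarrow> 'b \<times> 'b \<Rightarrow> 'a \<times> 'a \<Rightarrow> complex" where
  "complexify L x y =
     Complex (L (fst x) (fst y) - L (snd x) (snd y)) (L (fst x) (snd y) + L (snd x) (fst y))"

definition complex_twin_operator ::
  "('b::banach \<Rightarrow> 'a::banach \<Rightarrow> real) \<Rightarrow> ('b \<times> 'b \<Rightarrow> 'a \<times> 'a \<Rightarrow> complex) \<Rightarrow> bool" where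
  "complex_twin_operator p L \<longleftrightarrow>
     bounded_bilinear L \<and>
     (\<forall>c x y. L (cscale c x) y = c * L x y) \<and>
     (\<forall>c x y. L x (cscale c y) = c * L x y) \<and>
     (\<forall>y. \<exists>z. \<forall>x. complexify p x z = L x y) \<and>
     (\<forall>x. \<exists>z. \<forall>y. complexify p z y = L x y)"

section \<open>Twin semigroups\<close>

text \<open>
  The family is indexed by all reals, but only its members with \<open>t \<ge> 0\<close> are constrained.
  The identity twin operator is the pairing itself. The Laplace integrals converge absolutely
  by the growth bound and measurability, so the Bochner integral is not a default value.
\<close>

definition twin_semigroup ::
  "('b::banach \<Rightarrow> 'a::banach \<Rightarrow> real) \<Rightarrow> (real \<Rightarrow> 'b \<Rightarrow> 'a \<Rightarrow> real) \<Rightarrow> bool" where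
  "twin_semigroup p S \<longleftrightarrow>
     (\<forall>t\<ge>0. twin_operator p (S t)) \<and>
     S 0 = p \<and>
     (\<forall>t\<ge>0. \<forall>s\<ge>0. S (t + s) = twin_comp p (S t) (S s)) \<and>
     (\<forall>x y. (\<lambda>t. S t x y) \<in> borel_measurable (restrict_space borel {0..})) \<and>
     (\<exists>M\<ge>1. \<exists>\<omega>.
        (\<forall>t\<ge>0. \<forall>x y. \<bar>S t x y\<bar> \<le> M * exp (\<omega> * t) * norm y * norm x) \<and>
        (\<forall>l::real. l > \<omega> \<longrightarrow>
           (\<exists>R. twin_operator p R \<and>
              (\<forall>x y. R x y = (LINT t:{0..}|lborel. exp (- l * t) * S t x y)))) \<and>
        (\<forall>l::complex. Re l > \<omega> \<and> Im l \<noteq> 0 \<longrightarrow>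
           (\<exists>R. complex_twin_operator p R \<and>
              (\<forall>x y. R x y =
                 (LINT t:{0..}|lborel. exp (- l * complex_of_real t) * complexify (S t) x y)))))"

section \<open>Sequential completeness of the weak topology\<close>

definition sigma_topology :: "('b::banach \<Rightarrow> 'a::banach \<Rightarrow> real) \<Rightarrow> 'b topology" where
  "sigma_topology p = pullback_topology UNIV p (product_topology (\<lambda>y. euclideanreal) UNIV)"

text \<open>Cauchy sequences with respect to the uniformity of a translation-invariant topology:\<close>

definition Cauchy_in_topology :: "'b::ab_group_add topology \<Rightarrow> (nat \<Rightarrow> 'b) \<Rightarrow> bool" where
  "Cauchy_in_topology T X \<longleftrightarrow>
     (\<forall>U. openin T U \<and> 0 \<in> U \<longrightarrow> (\<exists>N. \<forall>m\<ge>N. \<forall>n\<ge>N. X m - X n \<in> U))"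

definition sequentially_complete :: "'b::ab_group_add topology \<Rightarrow> bool" where
  "sequentially_complete T \<longleftrightarrow>
     (\<forall>X. Cauchy_in_topology T X \<longrightarrow> (\<exists>l. limitin T X l sequentially))"

section \<open>Normalized functions of locally bounded variation and their Stieltjes integrals\<close>

definition bounded_variation_on :: "(real \<Rightarrow> real) \<Rightarrow> real \<Rightarrow> real \<Rightarrow> bool" where
  "bounded_variation_on G a b \<longleftrightarrow>
     (\<exists>B. \<forall>n (s::nat \<Rightarrow> real).
        (\<forall>i\<le>n. s i \<in> {a..b}) \<and> (\<forall>i<n. s i \<le> s (Suc i)) \<longrightarrow>
        (\<Sum>i<n. \<bar>G (s (Suc i)) - G (s i)\<bar>) \<le> B)"

definition NBV_loc :: "(real \<Rightarrow> real) \<Rightarrow> bool" where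
  "NBV_loc G \<longleftrightarrow>
     G 0 = 0 \<and>
     (\<forall>t>0. continuous (at_right t) G) \<and>
     (\<forall>T>0. bounded_variation_on G 0 T)"

text \<open>
  The signed Radon measure \<open>dG\<close> on \<open>[0,\<infinity>)\<close>, determined by \<open>dG [0,t] = G t\<close> for \<open>t > 0\<close>, is
  written as a difference \<open>\<mu> - \<nu>\<close> of two locally finite (positive) Borel measures. Letting
  \<open>t\<close> decrease to \<open>0\<close> shows that its mass at \<open>0\<close> is \<open>G(0+)\<close>, not \<open>G 0 = 0\<close>.
\<close>

definition represents_dG :: "(real \<Rightarrow> real) \<Rightarrow> real measure \<times> real measure \<Rightarrow> bool" where
  "represents_dG G = (\<lambda>(\<mu>, \<nu>).
     sets \<mu> = sets (restrict_space borel {0..}) \<and>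
     sets \<nu> = sets (restrict_space borel {0..}) \<and>
     (\<forall>t>0. emeasure \<mu> {0..t} < \<infinity> \<and> emeasure \<nu> {0..t} < \<infinity> \<and>
            measure \<mu> {0..t} - measure \<nu> {0..t} = G t))"

text \<open>
  The integral of \<open>f\<close> over \<open>[0,t]\<close> against \<open>dG\<close>. For \<open>G\<close> satisfying \<^const>\<open>NBV_loc\<close> a
  representing pair exists (split \<open>G\<close> into a difference of two nondecreasing functions). For
  \<open>f\<close> bounded and measurable on \<open>[0,t]\<close> the value does not depend on the pair chosen: if
  \<open>(\<mu>, \<nu>)\<close> and \<open>(\<mu>', \<nu>')\<close> both represent \<open>dG\<close>, then \<open>\<mu> + \<nu>'\<close> and \<open>\<mu>' + \<nu>\<close> agree on all
  intervals \<open>[0,s]\<close> with \<open>s > 0\<close>, hence are equal.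
\<close>

definition dG_integral :: "(real \<Rightarrow> real) \<Rightarrow> real \<Rightarrow> (real \<Rightarrow> real) \<Rightarrow> real" where
  "dG_integral G t f =
     (case (SOME m. represents_dG G m) of (\<mu>, \<nu>) \<Rightarrow>
        (LINT s:{0..t}|\<mu>. f s) - (LINT s:{0..t}|\<nu>. f s))"

end

theory Submission
  imports Defs
begin

text \<open>
  Fix \<open>t > 0\<close> and call a bounded Borel function \<open>f\<close> on \<open>[0,t]\<close> good if the functional
  \<open>y \<mapsto> \<integral>\<^bsub>[0,t]\<^esub> f d(V y)\<close> is given by pairing with an element of the diamond space. The theorem
  says that \<open>\<sigma> \<mapsto> F (t - \<sigma>)\<close> is good; in fact every bounded Borel function is.

  The indicator of \<open>[0,s]\<close> with \<open>0 < s \<le> t\<close> is good because its integral is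
  \<open>V s y = S s q y\<close> and a twin operator maps \<open>q\<close> to an element of the diamond space. Good
  functions form a vector space, and they are closed under uniformly bounded pointwise limits of
  sequences (\<open>signed_integral_limit\<close>): by dominated convergence the integrals converge for each
  \<open>y\<close>, so the representing elements are a Cauchy sequence for the weak topology, and sequential
  completeness supplies a limit, which represents the limit functional (\<open>representable_limit\<close>).
  As the intervals \<open>[0,s]\<close> form an intersection-stable generator of the Borel sets, Dynkin's
  theorem makes all indicators good, and monotone approximation by simple functions yields all
  bounded Borel functions (\<open>signed_integral_representable\<close>).

  The integral against \<open>dG\<close> refers to a choice of a pair of measures representing \<open>dG\<close>, so it
  must also be shown that such a pair exists (\<open>ex_represents_dG\<close>). The variation function \<open>P\<close>
  of \<open>G\<close> and \<open>P - G\<close> are nondecreasing. Passing to right limits makes both right-continuous and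
  does not change their difference on \<open>(0,\<infinity>)\<close>, where \<open>G\<close> is right-continuous;
  so the two Lebesgue-Stieltjes measures represent \<open>dG\<close>.
\<close>

section \<open>Functionals given by the pairing\<close>

definition representable :: "('b \<Rightarrow> 'a \<Rightarrow> real) \<Rightarrow> ('a \<Rightarrow> real) \<Rightarrow> bool" where
  "representable p \<phi> \<longleftrightarrow> (\<exists>u. \<forall>y. \<phi> y = p u y)"

lemma representable_linear:
  assumes "bounded_bilinear p" "representable p \<phi>" "representable p \<psi>"
  shows "representable p (\<lambda>y. a * \<phi> y + b * \<psi> y)"
proof -
  interpret bounded_bilinear p by fact
  obtain u v where "\<forall>y. \<phi> y = p u y" "\<forall>y. \<psi> y = p v y"
    using assms unfolding representable_def by auto
  then have "\<forall>y. a * \<phi> y + b * \<psi> y = p (a *\<^sub>R u + b *\<^sub>R v) y"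
    by (simp add: add_left scaleR_left)
  then show ?thesis
    unfolding representable_def by blast
qed

text \<open>
  Pointwise convergence of the functionals is exactly what makes the representing elements
  \<open>\<sigma>\<close>-Cauchy, because \<open>\<sigma>\<close> is the topology of pointwise convergence pulled back along the
  pairing. The \<open>\<sigma>\<close>-limit provided by completeness then pairs with each \<open>y\<close> as the limit does.
\<close>

lemma representable_limit:
  assumes "bounded_bilinear p" "sequentially_complete (sigma_topology p)"
    and rep: "\<And>n. representable p (\<phi> n)"
    and lim: "\<And>y. (\<lambda>n. \<phi> n y) \<longlonglongrightarrow> \<psi> y"
  shows "representable p \<psi>"
proof -
  interpret bounded_bilinear p by fact
  let ?P = "product_topology (\<lambda>y. euclideanreal) UNIV"
  obtain u where u: "\<And>n y. \<phi> n y = p (u n) y"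
    using rep unfolding representable_def by metis
  have "Cauchy_in_topology (sigma_topology p) u"
    unfolding Cauchy_in_topology_def
  proof (intro allI impI)
    fix U assume "openin (sigma_topology p) U \<and> 0 \<in> U"
    then obtain W where W: "openin ?P W" "U = p -` W" "p 0 \<in> W"
      unfolding sigma_topology_def openin_pullback_topology by auto
    \<comment> \<open>Convergence along the product filter captures the two independent indices of the
      Cauchy condition.\<close>
    have "((\<lambda>(m, n). p (u m - u n) y) \<longlongrightarrow> p 0 y) (sequentially \<times>\<^sub>F sequentially)" for y
    proof -
      have "((\<lambda>x. \<phi> (fst x) y - \<phi> (snd x) y) \<longlongrightarrow> \<psi> y - \<psi> y) (sequentially \<times>\<^sub>F sequentially)"
        by (intro tendsto_diff filterlim_compose[OF lim] filterlim_fst filterlim_snd)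
      then show ?thesis
        by (simp add: u diff_left zero_left case_prod_beta')
    qed
    then have "limitin ?P (\<lambda>(m, n). p (u m - u n)) (p 0) (sequentially \<times>\<^sub>F sequentially)"
      by (simp add: limitin_componentwise case_prod_beta')
    then have "\<forall>\<^sub>F (m, n) in sequentially \<times>\<^sub>F sequentially. p (u m - u n) \<in> W"
      using W unfolding limitin_def by (auto simp: case_prod_beta')
    then show "\<exists>N. \<forall>m\<ge>N. \<forall>n\<ge>N. u m - u n \<in> U"
      by (auto simp: eventually_prod_sequentially W)
  qed
  then obtain l where l: "limitin (sigma_topology p) u l sequentially"
    using assms(2) unfolding sequentially_complete_def by blast
  have "\<psi> y = p l y" for y
  proof -
    have "continuous_map (sigma_topology p) euclideanreal ((\<lambda>f. f y) \<circ> p)"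
      unfolding sigma_topology_def
      by (intro continuous_map_pullback continuous_map_product_projection) simp
    from continuous_map_limit[OF this l] have "(\<lambda>n. p (u n) y) \<longlonglongrightarrow> p l y"
      by (simp add: comp_def)
    with lim[of y] show ?thesis
      unfolding u by (rule LIMSEQ_unique)
  qed
  then show ?thesis
    unfolding representable_def by blast
qed

section \<open>From a generating family of sets to bounded measurable functions\<close>

text \<open>
  A family, indexed by \<open>y\<close>, of finite signed measures \<open>\<mu> y - \<nu> y\<close>; \<open>N\<close> carries
  their common sigma-algebra.
\<close>

locale finite_signed_measures =
  fixes p :: "'b::banach \<Rightarrow> 'a::banach \<Rightarrow> real"
    and \<mu> \<nu> :: "'a \<Rightarrow> 'c measure"
    and N :: "'c measure"
  assumes bilinear: "bounded_bilinear p"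
    and complete: "sequentially_complete (sigma_topology p)"
    and finite_\<mu>: "\<And>y. finite_measure (\<mu> y)"
    and finite_\<nu>: "\<And>y. finite_measure (\<nu> y)"
    and sets_\<mu>: "\<And>y. sets (\<mu> y) = sets N"
    and sets_\<nu>: "\<And>y. sets (\<nu> y) = sets N"
begin

definition signed_integral :: "('c \<Rightarrow> real) \<Rightarrow> 'a \<Rightarrow> real" where
  "signed_integral f y = integral\<^sup>L (\<mu> y) f - integral\<^sup>L (\<nu> y) f"

lemma space_\<mu>: "space (\<mu> y) = space N" and space_\<nu>: "space (\<nu> y) = space N"
  by (rule sets_eq_imp_space_eq[OF sets_\<mu>], rule sets_eq_imp_space_eq[OF sets_\<nu>])

lemma borel_measurable_families:
  assumes "f \<in> borel_measurable N"
  shows "f \<in> borel_measurable (\<mu> y)" "f \<in> borel_measurable (\<nu> y)"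
  using assms by (simp_all only: measurable_cong_sets[OF sets_\<mu> refl] measurable_cong_sets[OF sets_\<nu> refl])

lemma integrable_bounded:
  fixes f :: "'c \<Rightarrow> real"
  assumes "f \<in> borel_measurable N" "\<And>x. x \<in> space N \<Longrightarrow> \<bar>f x\<bar> \<le> B"
  shows "integrable (\<mu> y) f" "integrable (\<nu> y) f"
proof -
  interpret \<mu>: finite_measure "\<mu> y" by (rule finite_\<mu>)
  interpret \<nu>: finite_measure "\<nu> y" by (rule finite_\<nu>)
  note f = borel_measurable_families[OF assms(1)]
  show "integrable (\<mu> y) f"
    by (rule \<mu>.integrable_const_bound[where B = B]) (use f space_\<mu> space_\<nu> assms(2) in auto)
  show "integrable (\<nu> y) f"
    by (rule \<nu>.integrable_const_bound[where B = B]) (use f space_\<mu> space_\<nu> assms(2) in auto)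
qed

lemma signed_integral_limit:
  assumes f: "\<And>n. f n \<in> borel_measurable N"
    and bound: "\<And>n x. x \<in> space N \<Longrightarrow> \<bar>f n x\<bar> \<le> B"
    and lim: "\<And>x. x \<in> space N \<Longrightarrow> (\<lambda>n. f n x) \<longlonglongrightarrow> g x"
    and rep: "\<And>n. representable p (signed_integral (f n))"
  shows "representable p (signed_integral g)"
proof (rule representable_limit[OF bilinear complete rep])
  fix y
  interpret \<mu>: finite_measure "\<mu> y" by (rule finite_\<mu>)
  interpret \<nu>: finite_measure "\<nu> y" by (rule finite_\<nu>)
  have g: "g \<in> borel_measurable N"
    using borel_measurable_LIMSEQ_metric[OF f lim] .
  show "(\<lambda>n. signed_integral (f n) y) \<longlonglongrightarrow> signed_integral g y"
    unfolding signed_integral_def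
    by (intro tendsto_diff integral_dominated_convergence[where w = "\<lambda>_. B"])
       (use f g bound lim in \<open>auto simp: space_\<mu> space_\<nu> borel_measurable_families\<close>)
qed

lemma signed_integral_linear:
  assumes "f \<in> borel_measurable N" "\<And>x. x \<in> space N \<Longrightarrow> \<bar>f x\<bar> \<le> B"
    and "g \<in> borel_measurable N" "\<And>x. x \<in> space N \<Longrightarrow> \<bar>g x\<bar> \<le> C"
    and "representable p (signed_integral f)" "representable p (signed_integral g)"
  shows "representable p (signed_integral (\<lambda>x. a * f x + b * g x))"
proof -
  have "signed_integral (\<lambda>x. a * f x + b * g x) =
      (\<lambda>y. a * signed_integral f y + b * signed_integral g y)"
    using integrable_bounded[OF assms(1,2)] integrable_bounded[OF assms(3,4)]
    by (auto simp: signed_integral_def algebra_simps fun_eq_iff)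
  then show ?thesis
    using representable_linear[OF bilinear assms(5,6)] by simp
qed

text \<open>
  Dynkin's argument: the sets with representable indicator are closed under complements by
  linearity and under countable disjoint unions by \<open>signed_integral_limit\<close>. Complements are taken
  in the whole space, which therefore has to be representable even if it is not in \<open>E\<close>.
\<close>

lemma signed_integral_indicator:
  assumes gen: "sets N = sigma_sets (space N) E" "E \<subseteq> Pow (space N)" "Int_stable E"
    and whole: "representable p (signed_integral (indicator (space N)))"
    and rep: "\<And>A. A \<in> E \<Longrightarrow> representable p (signed_integral (indicator A))"
    and A: "A \<in> sets N"
  shows "representable p (signed_integral (indicator A))"
proof -
  have zero: "representable p (signed_integral (\<lambda>x. 0))"
    using signed_integral_linear[OF _ _ _ _ whole whole, of 1 1 0 0] by simp
  have "A \<in> sigma_sets (space N) E"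
    using A gen by simp
  with gen(3,2) show ?thesis
  proof (induction rule: sigma_sets_induct_disjoint)
    case (basic A)
    then show ?case by (rule rep)
  next
    case empty
    show ?case using zero by (simp add: indicator_def[abs_def])
  next
    case (compl A)
    have "signed_integral (indicator (space N - A)) =
        signed_integral (\<lambda>x. 1 * indicator (space N) x + (- 1) * indicator A x)"
    proof
      fix y
      show "signed_integral (indicator (space N - A)) y =
        signed_integral (\<lambda>x. 1 * indicator (space N) x + (- 1) * indicator A x) y"
        unfolding signed_integral_def
        by (intro arg_cong2[where f = minus] Bochner_Integration.integral_cong)
           (auto simp: indicator_def space_\<mu> space_\<nu>)
    qed
    moreover have "representable p \<dots>"
      by (rule signed_integral_linear[where B = 1 and C = 1]) (use compl[folded gen(1)] whole in auto)
    ultimately show ?case by simp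
  next
    case (union A)
    have A: "A i \<in> sets N" for i
      using union(2) gen(1) by auto
    have partial: "representable p (signed_integral (indicator (\<Union>i<n. A i)))" for n
    proof (induction n)
      case 0
      show ?case using zero by (simp add: indicator_def[abs_def])
    next
      case (Suc n)
      have "A i \<inter> A n = {}" if "i < n" for i
        using disjoint_family_onD[OF union(1), of i n] that by simp
      then have "(\<Union>i<n. A i) \<inter> A n = {}"
        by blast
      then have "(indicator (\<Union>i<Suc n. A i) :: 'c \<Rightarrow> real) =
          (\<lambda>x. 1 * indicator (\<Union>i<n. A i) x + 1 * indicator (A n) x)"
        by (auto simp: lessThan_Suc indicator_def fun_eq_iff)
      then show ?case
        using signed_integral_linear[where a = 1 and b = 1 and B = 1 and C = 1,
            OF _ _ _ _ Suc union(3)[of n]] A by simp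
    qed
    show ?case
    proof (rule signed_integral_limit[OF _ _ _ partial, where B = 1])
      show "(\<lambda>n. indicator (\<Union>i<n. A i) x) \<longlonglongrightarrow> (indicator (\<Union>i. A i) x :: real)" for x
        using LIMSEQ_indicator_UN[of A x] .
    qed (use A in auto)
  qed
qed

text \<open>
  Approximation from below by simple functions. The upper bound is part of the induction: it is
  inherited by the nonnegative approximants, as dominated convergence requires.
\<close>

lemma signed_integral_nonneg:
  assumes ind: "\<And>A. A \<in> sets N \<Longrightarrow> representable p (signed_integral (indicator A))"
    and "f \<in> borel_measurable N" "\<And>x. 0 \<le> f x" "\<And>x. x \<in> space N \<Longrightarrow> f x \<le> B"
  shows "representable p (signed_integral f)"
  using assms(2-)
proof (induction arbitrary: B rule: borel_measurable_induct_real)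
  case (set A)
  then show ?case by (auto intro: ind)
next
  case (mult u c)
  show ?case
  proof (cases "c = 0")
    case True
    then show ?thesis
      using ind[of "{}"] by (simp add: indicator_def[abs_def])
  next
    case False
    then have u: "u x \<le> B / c" if "x \<in> space N" for x
      using mult that by (simp add: field_simps)
    note rep = mult.IH[OF u]
    have "representable p (signed_integral (\<lambda>x. c * u x + 0 * u x))"
      by (rule signed_integral_linear[OF _ _ _ _ rep rep, where B = "B / c" and C = "B / c"])
         (use mult.hyps u in auto)
    then show ?thesis by simp
  qed
next
  case (add u v)
  have "u x \<le> B" "v x \<le> B" if "x \<in> space N" for x
    using add(1,2,4,5) add.prems[OF that] that by (smt (verit))+
  then show ?case
    using signed_integral_linear[where f = v and g = u and a = 1 and b = 1,
        OF add.hyps(3) _ add.hyps(1) _ add.IH(2,1), of B B B B] add.hyps(2,4) by simp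
next
  case (seq U)
  have U: "U i x \<le> B" if "x \<in> space N" for i x
    using incseq_le[OF _ seq.hyps(4)[OF that], of i] seq.prems[OF that] seq.hyps(3)
    by (fastforce simp: incseq_def le_fun_def)
  then show ?case
    using signed_integral_limit[of U B f, OF seq.hyps(1) _ seq.hyps(4) seq.IH[OF U]] seq.hyps(2) by simp
qed

theorem signed_integral_representable:
  assumes gen: "sets N = sigma_sets (space N) E" "E \<subseteq> Pow (space N)" "Int_stable E"
    and whole: "representable p (signed_integral (indicator (space N)))"
    and rep: "\<And>A. A \<in> E \<Longrightarrow> representable p (signed_integral (indicator A))"
    and f: "f \<in> borel_measurable N" "\<And>x. x \<in> space N \<Longrightarrow> \<bar>f x\<bar> \<le> B"
  shows "representable p (signed_integral f)"
proof -
  note ind = signed_integral_indicator[OF gen whole rep]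
  have "representable p (signed_integral (\<lambda>x. max 0 (f x)))"
       "representable p (signed_integral (\<lambda>x. max 0 (- f x)))"
    by (rule signed_integral_nonneg[OF ind, where B = "\<bar>B\<bar>"]; use f in force)+
  then have "representable p (signed_integral (\<lambda>x. 1 * max 0 (f x) + (- 1) * max 0 (- f x)))"
    by (intro signed_integral_linear[where B = B and C = B]) (use f in \<open>force+\<close>)
  also have "(\<lambda>x. 1 * max 0 (f x) + (- 1) * max 0 (- f x)) = f"
    by auto
  finally show ?thesis .
qed

end

section \<open>The measure of a function of locally bounded variation\<close>

definition variation_sums :: "(real \<Rightarrow> real) \<Rightarrow> real \<Rightarrow> real \<Rightarrow> real set" where
  "variation_sums G a b = {(\<Sum>i<n. \<bar>G (s (Suc i)) - G (s i)\<bar>) | n s.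
     (\<forall>i\<le>n. s i \<in> {a..b}) \<and> (\<forall>i<n. s i \<le> s (Suc i))}"

lemma bounded_variation_on_iff: "bounded_variation_on G a b \<longleftrightarrow> bdd_above (variation_sums G a b)"
  unfolding bounded_variation_on_def bdd_above_def variation_sums_def by blast

text \<open>
  Any chain in \<open>[a,x]\<close> can be prolonged by the points \<open>x\<close> and \<open>y\<close>. This gives monotonicity of
  the variation and of the variation minus \<open>G\<close> at once.
\<close>

lemma variation_increment:
  assumes "a \<le> x" "x \<le> y" "bounded_variation_on G a y"
  shows "Sup (variation_sums G a x) + \<bar>G y - G x\<bar> \<le> Sup (variation_sums G a y)"
proof -
  have "Sup (variation_sums G a x) \<le> Sup (variation_sums G a y) - \<bar>G y - G x\<bar>"
  proof (rule cSup_least)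
    have "0 \<in> variation_sums G a x"
      unfolding variation_sums_def using assms
      by (auto intro!: exI[of _ 0] exI[of _ "\<lambda>_. x"])
    then show "variation_sums G a x \<noteq> {}" by blast
  next
    fix v assume "v \<in> variation_sums G a x"
    then obtain n s where s: "v = (\<Sum>i<n. \<bar>G (s (Suc i)) - G (s i)\<bar>)"
        "\<forall>i\<le>n. s i \<in> {a..x}" "\<forall>i<n. s i \<le> s (Suc i)"
      unfolding variation_sums_def by blast
    define s' where "s' i = (if i \<le> n then s i else if i = Suc n then x else y)" for i
    have "(\<Sum>i<Suc (Suc n). \<bar>G (s' (Suc i)) - G (s' i)\<bar>) =
        v + \<bar>G x - G (s n)\<bar> + \<bar>G y - G x\<bar>"
      unfolding s(1) by (simp add: s'_def)
    moreover have "(\<Sum>i<Suc (Suc n). \<bar>G (s' (Suc i)) - G (s' i)\<bar>) \<in> variation_sums G a y"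
    proof -
      have "\<forall>i\<le>Suc (Suc n). s' i \<in> {a..y}"
        using s(2) assms by (force simp: s'_def)
      moreover have "\<forall>i<Suc (Suc n). s' i \<le> s' (Suc i)"
        using s(2,3) assms by (auto simp: s'_def less_Suc_eq)
      ultimately show ?thesis
        unfolding variation_sums_def by blast
    qed
    ultimately have "v + \<bar>G x - G (s n)\<bar> + \<bar>G y - G x\<bar> \<le> Sup (variation_sums G a y)"
      using assms(3) by (metis bounded_variation_on_iff cSup_upper)
    then show "v \<le> Sup (variation_sums G a y) - \<bar>G y - G x\<bar>"
      by linarith
  qed
  then show ?thesis by linarith
qed

text \<open>For monotone \<open>f\<close>, this infimum is the limit of \<open>f\<close> from the right.\<close>

definition right_limit :: "(real \<Rightarrow> real) \<Rightarrow> real \<Rightarrow> real" where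
  "right_limit f x = Inf (f ` {x<..})"

context
  fixes f :: "real \<Rightarrow> real"
  assumes f: "mono f"
begin

lemma tendsto_right_limit: "(f \<longlongrightarrow> right_limit f x) (at_right x)"
  using Lim_right_bound[of UNIV x f "f x"] monoD[OF f] by (simp add: right_limit_def)

lemma right_limit_le: "x < y \<Longrightarrow> right_limit f x \<le> f y"
  unfolding right_limit_def
  by (rule cInf_lower) (auto intro!: bdd_belowI[of _ "f x"] monoD[OF f])

lemma le_right_limit: "f x \<le> right_limit f x"
  unfolding right_limit_def by (rule cInf_greatest) (auto intro!: monoD[OF f])

lemma mono_right_limit: "mono (right_limit f)"
proof (rule monoI)
  fix x y :: real assume "x \<le> y"
  then show "right_limit f x \<le> right_limit f y"
    by (cases "x = y") (auto intro: order_trans[OF right_limit_le le_right_limit])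
qed

text \<open>
  For \<open>y > x\<close> the value at \<open>y\<close> lies between the right limit at \<open>x\<close> and \<open>f (2 y - x)\<close>, because
  \<open>2 y - x > y\<close>; the latter tends to the right limit at \<open>x\<close> as \<open>y\<close> decreases to \<open>x\<close>.
\<close>

lemma continuous_right_limit: "continuous (at_right x) (right_limit f)"
  unfolding continuous_within
proof (rule tendsto_sandwich[OF _ _ tendsto_const])
  show "\<forall>\<^sub>F y in at_right x. right_limit f x \<le> right_limit f y"
    by (auto simp: eventually_at_filter intro!: always_eventually monoD[OF mono_right_limit])
  show "\<forall>\<^sub>F y in at_right x. right_limit f y \<le> f (2 * y - x)"
    by (auto simp: eventually_at_filter intro!: always_eventually right_limit_le)
  have "filterlim (\<lambda>y. 2 * y - x) (at_right x) (at_right x)"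
    unfolding filterlim_at
    by (auto simp: eventually_at_filter intro!: tendsto_eq_intros)
  then show "((\<lambda>y. f (2 * y - x)) \<longlongrightarrow> right_limit f x) (at_right x)"
    by (rule filterlim_compose[OF tendsto_right_limit])
qed

text \<open>
  Pushing forward along \<open>max 0\<close> collects the increment of the right limit on \<open>(-1,0]\<close> as mass at \<open>0\<close>. For
  an \<open>f\<close> that is constant on \<open>(-\<infinity>,0]\<close> this increment is the jump of \<open>f\<close> to its right limit at
  \<open>0\<close>; so the measure of \<open>[0,t]\<close> includes the mass \<open>f(0+) - f(0)\<close> that \<open>dG\<close> has at \<open>0\<close>.
\<close>

definition stieltjes :: "real measure" where
  "stieltjes = distr (restrict_space (interval_measure (right_limit f)) {-1<..})
     (restrict_space borel {0..}) (max 0)"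

lemma sets_stieltjes: "sets stieltjes = sets (restrict_space borel {0..})"
  by (simp add: stieltjes_def)

lemma emeasure_stieltjes:
  assumes "0 \<le> t"
  shows "emeasure stieltjes {0..t} = ennreal (right_limit f t - right_limit f (-1))"
proof -
  let ?R = "restrict_space (interval_measure (right_limit f)) {-1<..}"
  have "emeasure stieltjes {0..t} = emeasure ?R (max 0 -` {0..t} \<inter> space ?R)"
    unfolding stieltjes_def
  proof (rule emeasure_distr)
    have "max 0 \<in> borel_measurable (borel :: real measure)"
      by measurable
    then have "max 0 \<in> borel_measurable ?R"
      by (intro measurable_restrict_space1) (simp add: measurable_cong_sets[OF sets_interval_measure refl])
    then show "max 0 \<in> measurable ?R (restrict_space borel {0..})"
      by (auto intro!: measurable_restrict_space2)
    show "{0..t} \<in> sets (restrict_space borel {0..})"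
      by (auto simp: sets_restrict_space image_iff intro!: bexI[of _ "{0..t}"])
  qed
  also have "max 0 -` {0..t} \<inter> space ?R = {-1<..t}"
    using assms by (auto simp: space_restrict_space max_def split: if_splits)
  also have "emeasure ?R {-1<..t} = emeasure (interval_measure (right_limit f)) {-1<..t}"
    by (rule emeasure_restrict_space) auto
  also have "\<dots> = ennreal (right_limit f t - right_limit f (-1))"
    using assms by (intro emeasure_interval_measure_Ioc)
      (auto intro: monoD[OF mono_right_limit] continuous_right_limit)
  finally show ?thesis .
qed

end

text \<open>
  The function \<open>H\<close> below extends \<open>G\<close> by \<open>G 0 = 0\<close> to the negative axis, so that it is
  right-continuous at every point except possibly \<open>0\<close>, which is the point where \<open>G\<close> may jump.
  Away from \<open>0\<close> the right limits of the two monotone parts thus differ by \<open>H\<close>.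
\<close>

lemma ex_represents_dG:
  assumes "NBV_loc G"
  shows "\<exists>m. represents_dG G m"
proof -
  define H where "H x = G (max 0 x)" for x
  define P where "P x = Sup (variation_sums G 0 (max 0 x))" for x
  define Q where "Q x = P x - H x" for x
  have incr: "P x + \<bar>H y - H x\<bar> \<le> P y" if "x \<le> y" for x y
  proof (cases "0 < y")
    case True
    then have "bounded_variation_on G 0 y"
      using assms by (auto simp: NBV_loc_def)
    then show ?thesis
      using variation_increment[of 0 "max 0 x" y G] that True by (simp add: P_def H_def)
  next
    case False
    then have "max 0 x = 0" "max 0 y = 0" using that by auto
    then show ?thesis by (simp add: P_def H_def)
  qed
  have P: "mono P" and Q: "mono Q"
    by (rule monoI, use incr in \<open>fastforce simp: Q_def\<close>)+
  have H: "(H \<longlongrightarrow> H t) (at_right t)" if "t \<noteq> 0" for t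
  proof (cases "t > 0")
    case True
    then have "(G \<longlongrightarrow> H t) (at_right t)"
      using assms by (auto simp: NBV_loc_def continuous_within H_def max_def)
    then show ?thesis
    proof (rule Lim_transform_eventually)
      show "\<forall>\<^sub>F x in at_right t. G x = H x"
        using True by (auto simp: eventually_at_filter H_def intro!: always_eventually)
    qed
  next
    case False
    then have "t < 0" using that by simp
    then have "\<forall>\<^sub>F x in at_right t. x < 0"
      using eventually_at_right_real[of t 0] by (auto elim: eventually_mono)
    then have "\<forall>\<^sub>F x in at_right t. H t = H x"
      using \<open>t < 0\<close> by (auto simp: H_def max_def elim!: eventually_mono)
    then show ?thesis
      by (rule Lim_transform_eventually[OF tendsto_const])
  qed
  have diff: "right_limit P t - right_limit Q t = H t" if "t \<noteq> 0" for t
  proof (rule tendsto_unique)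
    show "((\<lambda>x. P x - Q x) \<longlongrightarrow> right_limit P t - right_limit Q t) (at_right t)"
      by (intro tendsto_diff tendsto_right_limit P Q)
    show "((\<lambda>x. P x - Q x) \<longlongrightarrow> H t) (at_right t)"
      using H[OF that] by (simp add: Q_def)
  qed auto
  have m: "measure (stieltjes P) {0..t} - measure (stieltjes Q) {0..t} = G t" if "t > 0" for t
  proof -
    have "right_limit P (-1) \<le> right_limit P t" "right_limit Q (-1) \<le> right_limit Q t"
      using that P Q by (auto intro!: monoD[OF mono_right_limit])
    then have "measure (stieltjes P) {0..t} - measure (stieltjes Q) {0..t} = H t - H (-1)"
      using that diff[of t] diff[of "-1"]
      by (simp add: measure_def emeasure_stieltjes P Q)
    also have "\<dots> = G t"
      using assms that by (simp add: H_def NBV_loc_def)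
    finally show ?thesis .
  qed
  have "represents_dG G (stieltjes P, stieltjes Q)"
    using m by (simp add: represents_dG_def sets_stieltjes emeasure_stieltjes P Q)
  then show ?thesis by blast
qed

section \<open>Representing the Stieltjes integrals\<close>

text \<open>
  Degenerate generators \<open>{0..s}\<close> with \<open>s \<le> 0\<close> are included: they are what intersections
  of \<open>[0,t]\<close> with rays \<open>(-\<infinity>,s]\<close> yield.
\<close>

lemma sets_borel_Icc:
  "sets (restrict_space borel {0..t::real}) = sigma_sets {0..t} ((\<lambda>s. {0..s}) ` {..t})"
proof -
  have borel: "sets borel = sigma_sets UNIV (range (atMost :: real \<Rightarrow> real set))"
    by (rule trans[OF arg_cong[where f = sets, OF borel_eq_atMost]]) simp
  have "sets (restrict_space borel {0..t}) = (\<inter>) {0..t} ` sigma_sets UNIV (range atMost)"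
    by (simp only: sets_restrict_space borel)
  also have "\<dots> = sigma_sets {0..t} ((\<inter>) {0..t} ` range atMost)"
    by (rule sigma_sets_Int) (simp_all flip: borel)
  also have "(\<inter>) {0..t} ` range atMost = (\<lambda>s. {0..s}) ` {..t}"
  proof -
    have "(\<inter>) {0..t} ` range atMost = (\<lambda>s. {0..s}) ` range (min t)"
      unfolding image_image by (rule image_cong) auto
    also have "range (min t) = {..t}"
    proof (intro equalityI subsetI)
      fix x assume "x \<in> {..t}"
      then have "x = min t x" by simp
      then show "x \<in> range (min t)" by (rule range_eqI)
    qed auto
    finally show ?thesis .
  qed
  finally show ?thesis .
qed

text \<open>
  The values \<open>V s y\<close> for \<open>s > 0\<close> are the signed measures of the intervals \<open>[0,s]\<close>, and these
  determine everything. The set \<open>{0}\<close> is the one generator not covered directly, since its signed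
  measure is \<open>V(0+) y\<close> rather than \<open>V 0 y\<close>; it is reached as the limit of \<open>[0, t/n]\<close>.
\<close>

lemma dG_integral_representable:
  assumes p: "bounded_bilinear p" "sequentially_complete (sigma_topology p)"
    and V: "\<And>y. NBV_loc (\<lambda>\<sigma>. V \<sigma> y)" "\<And>\<sigma>. \<sigma> > 0 \<Longrightarrow> representable p (V \<sigma>)"
    and "t > 0" and f: "f \<in> borel_measurable (restrict_space borel {0..t})" "bounded (f ` {0..t})"
  shows "representable p (\<lambda>y. dG_integral (\<lambda>\<sigma>. V \<sigma> y) t f)"
proof -
  define m where "m y = (SOME m. represents_dG (\<lambda>\<sigma>. V \<sigma> y) m)" for y
  have "represents_dG (\<lambda>\<sigma>. V \<sigma> y) (m y)" for y
    unfolding m_def by (rule someI_ex) (rule ex_represents_dG[OF V(1)])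
  then have m: "sets (fst (m y)) = sets (restrict_space borel {0..})"
      "sets (snd (m y)) = sets (restrict_space borel {0..})"
      "s > 0 \<Longrightarrow> emeasure (fst (m y)) {0..s} < \<infinity>"
      "s > 0 \<Longrightarrow> emeasure (snd (m y)) {0..s} < \<infinity>"
      "s > 0 \<Longrightarrow> measure (fst (m y)) {0..s} - measure (snd (m y)) {0..s} = V s y" for y s
    unfolding represents_dG_def by (auto simp: case_prod_beta)
  have sp: "space (fst (m y)) = {0..}" "space (snd (m y)) = {0..}" for y
    using m(1,2)[THEN sets_eq_imp_space_eq] by (simp_all add: space_restrict_space)
  have Icc: "{0..s} \<in> sets (fst (m y))" "{0..s} \<in> sets (snd (m y))" for y s
    unfolding m by (auto simp: sets_restrict_space image_iff intro!: bexI[of _ "{0..s}"])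
  have Int: "{0..t} \<inter> space (fst (m y)) \<in> sets (fst (m y))"
            "{0..t} \<inter> space (snd (m y)) \<in> sets (snd (m y))" for y
    using Icc[of t] by (auto simp: sp Int_absorb2)
  define N where "N = restrict_space borel {0..t}"
  define \<mu> where "\<mu> y = restrict_space (fst (m y)) {0..t}" for y
  define \<nu> where "\<nu> y = restrict_space (snd (m y)) {0..t}" for y
  have sets: "sets (\<mu> y) = sets N" "sets (\<nu> y) = sets N" for y
    unfolding \<mu>_def \<nu>_def N_def
    by (simp_all add: sets_restrict_space_cong[OF m(1)] sets_restrict_space_cong[OF m(2)]
      sets_restrict_restrict_space Int_absorb1)
  interpret finite_signed_measures p \<mu> \<nu> N
  proof (rule finite_signed_measures.intro)
    fix y
    show "finite_measure (\<mu> y)"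
      unfolding \<mu>_def using m(3)[OF \<open>t > 0\<close>, of y] Int[of y]
      by (auto intro!: finite_measureI simp: space_restrict_space sp emeasure_restrict_space Int_absorb2)
    show "finite_measure (\<nu> y)"
      unfolding \<nu>_def using m(4)[OF \<open>t > 0\<close>, of y] Int[of y]
      by (auto intro!: finite_measureI simp: space_restrict_space sp emeasure_restrict_space Int_absorb2)
  qed (use p sets in auto)
  have ind: "signed_integral (indicator {0..s}) = V s" if "0 < s" "s \<le> t" for s
  proof
    fix y
    have "measure (\<mu> y) {0..s} = measure (fst (m y)) {0..s}"
         "measure (\<nu> y) {0..s} = measure (snd (m y)) {0..s}"
      unfolding \<mu>_def \<nu>_def using that Int by (auto intro!: measure_restrict_space)
    moreover have "space (\<mu> y) = {0..t}" "space (\<nu> y) = {0..t}"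
      by (auto simp: \<mu>_def \<nu>_def space_restrict_space sp)
    ultimately show "signed_integral (indicator {0..s}) y = V s y"
      using m(5)[of s y] that by (simp add: signed_integral_def Int_absorb2)
  qed
  have rep_pos: "representable p (signed_integral (indicator {0..s}))" if "0 < s" "s \<le> t" for s
    using V(2) ind that by simp
  have meas: "{0..s} \<in> sets N" if "s \<le> t" for s
    unfolding N_def sets_borel_Icc using that by (blast intro: sigma_sets.Basic)
  have rep_0: "representable p (signed_integral (indicator {0..0}))"
  proof (rule signed_integral_limit[where f = "\<lambda>n. indicator {0..t / Suc n}" and B = 1])
    fix n
    have "t / Suc n \<le> t" "0 < t / Suc n" using \<open>t > 0\<close> by (auto simp: field_simps)
    then show "indicator {0..t / Suc n} \<in> borel_measurable N"
        "representable p (signed_integral (indicator {0..t / Suc n}))"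
      using meas rep_pos by auto
  next
    fix x
    have lim: "(\<lambda>n. t / Suc n) \<longlonglongrightarrow> 0"
      by (rule LIMSEQ_Suc[OF lim_const_over_n])
    show "(\<lambda>n. indicator {0..t / Suc n} x :: real) \<longlonglongrightarrow> indicator {0..0} x"
    proof (cases "x > 0")
      case True
      then have "\<forall>\<^sub>F n in sequentially. indicator {0..0} x = (indicator {0..t / Suc n} x :: real)"
        using order_tendstoD(2)[OF lim True] by (auto elim!: eventually_mono)
      then show ?thesis by (rule Lim_transform_eventually[OF tendsto_const])
    next
      case False
      then show ?thesis using \<open>t > 0\<close> by (auto simp: indicator_def)
    qed
  qed auto
  have rep: "representable p (signed_integral (indicator {0..s}))" if "s \<le> t" for s
  proof -
    consider "s < 0" | "s = 0" | "0 < s" by linarith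
    then show ?thesis
    proof cases
      case 1
      then have "signed_integral (indicator {0..s}) = (\<lambda>y. 0 * V t y + 0 * V t y)"
        by (simp add: signed_integral_def fun_eq_iff)
      then show ?thesis
        using representable_linear[OF p(1) V(2) V(2), OF \<open>t > 0\<close> \<open>t > 0\<close>, of 0 0] by simp
    qed (use rep_0 rep_pos that in auto)
  qed
  obtain B where B: "\<And>x. x \<in> {0..t} \<Longrightarrow> \<bar>f x\<bar> \<le> B"
    using f(2) unfolding bounded_iff by (metis imageI real_norm_def)
  have spN: "space N = {0..t}"
    by (simp add: N_def space_restrict_space)
  have "representable p (signed_integral f)"
  proof (rule signed_integral_representable)
    show "sets N = sigma_sets (space N) ((\<lambda>s. {0..s}) ` {..t})"
      unfolding spN unfolding N_def by (rule sets_borel_Icc)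
    show "Int_stable ((\<lambda>s. {0..s}) ` {..t})"
      by (auto simp: Int_stable_def image_iff intro!: bexI[of _ "min _ _"])
  qed (use spN B f(1) rep in \<open>auto simp: N_def\<close>)
  also have "signed_integral f = (\<lambda>y. dG_integral (\<lambda>\<sigma>. V \<sigma> y) t f)"
    using Int unfolding dG_integral_def m_def[symmetric]
    by (auto simp: signed_integral_def \<mu>_def \<nu>_def case_prod_beta integral_restrict_space
        set_lebesgue_integral_def)
  finally show ?thesis .
qed

theorem lemma8p3:
  fixes p :: "'b::banach \<Rightarrow> 'a::banach \<Rightarrow> real"
    and S :: "real \<Rightarrow> 'b \<Rightarrow> 'a \<Rightarrow> real"
    and q :: 'b
    and V :: "real \<Rightarrow> 'a \<Rightarrow> real"
    and F :: "real \<Rightarrow> real"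
  assumes "norming_dual_pair p"
    and "twin_semigroup p S"
    and "sequentially_complete (sigma_topology p)"
    and "\<And>y. V 0 y = 0"
    and "\<And>\<sigma> y. \<sigma> > 0 \<Longrightarrow> V \<sigma> y = S \<sigma> q y"
    and "\<And>y. NBV_loc (\<lambda>\<sigma>. V \<sigma> y)"
    and "\<And>T. T > 0 \<Longrightarrow> bounded (F ` {0..T})"
    and "F \<in> borel_measurable (restrict_space borel {0..})"
  shows "\<forall>t>0. \<exists>u. \<forall>y. dG_integral (\<lambda>\<sigma>. V \<sigma> y) t (\<lambda>\<sigma>. F (t - \<sigma>)) = p u y"
proof (intro allI impI)
  fix t :: real assume t: "t > 0"
  have V: "representable p (V \<sigma>)" if "\<sigma> > 0" for \<sigma>
  proof -
    have "twin_operator p (S \<sigma>)"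
      using assms(2) less_imp_le[OF that] unfolding twin_semigroup_def by blast
    then obtain u where "\<And>y. p u y = S \<sigma> q y"
      unfolding twin_operator_def by blast
    then show ?thesis
      using assms(5)[OF that] unfolding representable_def by (auto intro!: exI[of _ u])
  qed
  have reflect: "(\<lambda>\<sigma>. t - \<sigma>) \<in> measurable (restrict_space borel {0..t}) (restrict_space borel {0..})"
    by (intro measurable_restrict_space2[OF _ measurable_restrict_space1])
       (auto simp: space_restrict_space)
  have "representable p (\<lambda>y. dG_integral (\<lambda>\<sigma>. V \<sigma> y) t (\<lambda>\<sigma>. F (t - \<sigma>)))"
  proof (rule dG_integral_representable[OF _ assms(3,6) V t])
    show "bounded_bilinear p"
      using assms(1) unfolding norming_dual_pair_def by blast
    show "(\<lambda>\<sigma>. F (t - \<sigma>)) \<in> borel_measurable (restrict_space borel {0..t})"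
      using measurable_compose[OF reflect assms(8)] .
    show "bounded ((\<lambda>\<sigma>. F (t - \<sigma>)) ` {0..t})"
      by (rule bounded_subset[OF assms(7)[OF t]]) (auto intro!: imageI)
  qed
  then show "\<exists>u. \<forall>y. dG_integral (\<lambda>\<sigma>. V \<sigma> y) t (\<lambda>\<sigma>. F (t - \<sigma>)) = p u y"
    unfolding representable_def .
qed

end
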